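(* Let $\Pi=(\Lambda,X,f)$ be an instance of a linear-$p$-parametric minimization problem satisfying the standing assumptions of the context, where $\Lambda$ is a polytope described by $m$ inequalities, and let $\varepsilon>0$, $\alpha\geq1$. Let $s_{\max}$ be the cardinality of the set $S$ in Algorithm 1 (described in the context) immediately before the optional redundancy removal in Step 13. Then $$s_{\max}\in\mathcal{O}\left(m^{\lfloor p/2\rfloor\cdot\lceil p/2\rceil}\cdot\mathrm{poly}(\langle\Pi\rangle,\varepsilon^{-1})^{p+1}\right).$$
   Context: **Problem.** Fix $p\in\mathbb{N}_{>0}$. A linear-$p$-parametric minimization problem is a set of instances $\Pi=(\Lambda,X,f)$, where $\Lambda=\{\lambda\in\mathbb{R}^p: Q\lambda\geq d\}$ with $m\in\mathbb{N}_{>0}$, $Q\in\mathbb{Q}^{m\times p}$, $d\in\mathbb{Q}^m$; $X$ is a set (of feasible solutions); and $f=(f_1,\ldots,f_{p+1})^{\mathsf T}:X\to\mathbb{R}^{p+1}$. The sets/functions $X,f$ may be encoded implicitly; $\langle\cdot\rangle$ denotes binary encoding length. Let $F_\lambda(x)=\sum_{i=1}^p\lambda_i f_i(x)+f_{p+1}(x)$; for $\lambda\in\Lambda$, $\Pi(\lambda)$ is the non-parametric problem $\min_{x\in X}F_\lambda(x)$ with optimal value $F^*(\lambda)$. **Standing assumptions.** (a) $f$ is polynomial-time computable (so $f(x)$ is rational with encoding length polynomial in $\langle\Pi\rangle$ and $\langle x\rangle$), every $\Pi(\lambda)$, $\lambda\in\Lambda$, is bounded, and there is a polynomial bound (depending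 only on the parametric problem) such that every $\Pi(\lambda)$ has an optimal solution of encoding length bounded by this polynomial in $\langle\Pi\rangle$. $X_{\mathrm{pol}}\subseteq X$ denotes the (finite) set of all solutions with encoding length bounded by such a (fixed) polynomial in $\langle\Pi\rangle$. (b) $p$ is a constant, $\Lambda$ is $p$-dimensional, and $Q\lambda\geq d$ contains no redundant inequalities. (c) $F_\lambda(x)\geq0$ for all $\lambda\in\Lambda$, $x\in X$. (d) An $\alpha$-approximation oracle $\mathsf{Alg}_\alpha$ is available: on input $\lambda\in\Lambda$ it returns some $x\in X_{\mathrm{pol}}$ with $F_\lambda(x)\leq\alpha F^*(\lambda)$. **Polyhedra.** For $x\in X$ let $h(x)=\{(\lambda,z)\in\mathbb{R}^{p+1}: z=F_\lambda(x)\}$ and $H(x)=\{(\lambda,z)\in\mathbb{R}^{p+1}: z\leq F_\lambda(x)\}$. For $S\subseteq X$ let $\mathcal{A}(S)=\bigcap_{x\in S}H(x)\cap(\Lambda\times\mathbb{R})$. $\mathsf{vert}(\cdot)$ denotes the vertex set. **Algorithm 1** (input: $\Pi$, $\varepsilon\geq0$). 1. Choose an arbitrary $\lambda^0\in\Lambda$. 2. $V\gets\{\lambda^0\}$. 3. $x^0\gets\mathsf{Alg}_\alpha(\lambda^0)$. 4. $S\gets\{x^0\}$. 5. Compute $\mathsf{vert}(\mathcal{A}(S))$. 6. For each $(\lambda,z)\in\mathsf{vert}(\mathcal{A}(S))$: 7. if $\lambda\notin V$: 8. $V\gets V\cup\{\lambda\}$; 9. $x\gets\mathsf{Alg}_\alpha(\lambda)$;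 10. if $(1+\varepsilon)F_\lambda(x)<z$: 11. $S\gets S\cup\{x\}$, 12. go to Step 5. 13. (When the loop finishes; optional) remove from $S$ redundant solutions, i.e. those $x$ for which $h(x)$ does not contain a facet of $\mathcal{A}(S)$. 14. Return $S$. **Convention.** $\mathrm{poly}(\cdot)$ denotes some polynomial function of bounded degree, which depends only on the parametric problem (and not on the particular instance $\Pi$ or on $\varepsilon$); $p$ is constant. *)

theory Defs
  imports "HOL-Analysis.Analysis" "HOL-Computational_Algebra.Polynomial"
begin

section \<open>Binary encodings\<close>

text \<open>
  All encodings are bit strings. Numbers are encoded prefix-free: every payload bit is preceded
  by \<open>True\<close> and the end is marked by \<open>False\<close>, so that concatenations are uniquely decodable.
\<close>

fun nat_bits :: "nat \<Rightarrow> bool list" where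
  "nat_bits n = (if n = 0 then [] else odd n # nat_bits (n div 2))"

declare nat_bits.simps [simp del]

definition delimit :: "bool list \<Rightarrow> bool list" where
  "delimit w = concat (map (\<lambda>b. [True, b]) w) @ [False]"

definition enc_nat :: "nat \<Rightarrow> bool list" where
  "enc_nat n = delimit (nat_bits n)"

definition enc_int :: "int \<Rightarrow> bool list" where
  "enc_int k = (k < 0) # enc_nat (nat \<bar>k\<bar>)"

definition enc_rat :: "rat \<Rightarrow> bool list" where
  "enc_rat r = (let (a, b) = quotient_of r in enc_int a @ enc_nat (nat b))"

definition enc_vec :: "(rat, 'p::{finite,linorder}) vec \<Rightarrow> bool list" where
  "enc_vec v = concat (map (\<lambda>i. enc_rat (v $ i)) (sorted_list_of_set (UNIV :: 'p set)))"

text \<open>Vectors with \<open>p + 1\<close> components are pairs of a vector with \<open>p\<close> components and a scalar.\<close>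

definition enc_point :: "(rat, 'p::{finite,linorder}) vec \<times> rat \<Rightarrow> bool list" where
  "enc_point u = enc_vec (fst u) @ enc_rat (snd u)"

definition real_vec :: "(rat, 'p::finite) vec \<Rightarrow> (real, 'p) vec" where
  "real_vec v = (\<chi> i. real_of_rat (v $ i))"

definition real_point :: "(rat, 'p::finite) vec \<times> rat \<Rightarrow> (real, 'p) vec \<times> real" where
  "real_point u = (real_vec (fst u), real_of_rat (snd u))"


section \<open>Turing machines\<close>

text \<open>
  Deterministic machines with a single two-way infinite tape. States and tape symbols are natural
  numbers, \<open>0\<close> being both the initial state and the blank; a machine is a finite partial transition
  table, and it halts when no transition applies. In a configuration \<open>(q, l, r)\<close> the head scans the
  first symbol of \<open>r\<close>, and \<open>l\<close> is the part of the tape left of the head, nearest cell first; cells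
  beyond the two lists are blank.
\<close>

datatype move = Left | Stay | Right

type_synonym machine = "nat \<times> nat \<Rightarrow> (nat \<times> nat \<times> move) option"
type_synonym config = "nat \<times> nat list \<times> nat list"

definition scanned :: "nat list \<Rightarrow> nat" where
  "scanned r = (case r of [] \<Rightarrow> 0 | s # _ \<Rightarrow> s)"

fun tm_step :: "machine \<Rightarrow> config \<Rightarrow> config" where
  "tm_step M (q, l, r) =
    (case M (q, scanned r) of
       None \<Rightarrow> (q, l, r)
     | Some (q', s, Left) \<Rightarrow> (q', tl l, scanned l # s # tl r)
     | Some (q', s, Stay) \<Rightarrow> (q', l, s # tl r)
     | Some (q', s, Right) \<Rightarrow> (q', s # l, tl r))"

definition bit_symbol :: "bool \<Rightarrow> nat" where
  "bit_symbol b = (if b then 2 else 1)"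

text \<open>The output is read from the head position rightwards up to the first blank.\<close>

definition computes_within :: "machine \<Rightarrow> nat \<Rightarrow> bool list \<Rightarrow> bool list \<Rightarrow> bool" where
  "computes_within M t u v \<longleftrightarrow>
    (\<exists>q l r. (tm_step M ^^ t) (0, [], map bit_symbol u) = (q, l, r) \<and>
             M (q, scanned r) = None \<and>
             takeWhile (\<lambda>s. s \<noteq> 0) r = map bit_symbol v)"


section \<open>Linear parametric minimization problems\<close>

text \<open>
  The index type \<^typ>\<open>'p\<close> has \<open>p\<close> elements. The list \<open>ineqs\<close> consists of the \<open>m\<close> rows \<open>(q, d)\<close> of
  \<open>Q \<lambda> \<ge> d\<close>; the value \<open>objs x\<close> is the pair of \<open>(f\<^sub>1 x, \<dots>, f\<^sub>p x)\<close> and \<open>f\<^sub>p\<^sub>+\<^sub>1 x\<close>; \<open>impl_code\<close> is the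
  (implicit) encoding of the feasible set and the objectives, and \<open>sol_code\<close> encodes solutions.
\<close>

record ('p, 'x) ppinst =
  ineqs :: "((rat, 'p) vec \<times> rat) list"
  sols :: "'x set"
  objs :: "'x \<Rightarrow> (real, 'p) vec \<times> real"
  impl_code :: "bool list"
  sol_code :: "'x \<Rightarrow> bool list"

definition satisfies :: "(real, 'p::finite) vec \<Rightarrow> (rat, 'p) vec \<times> rat \<Rightarrow> bool" where
  "satisfies lam c \<longleftrightarrow> real_vec (fst c) \<bullet> lam \<ge> real_of_rat (snd c)"

definition params :: "('p::finite, 'x) ppinst \<Rightarrow> (real, 'p) vec set" where
  "params I = {lam. \<forall>i < length (ineqs I). satisfies lam (ineqs I ! i)}"

definition inst_code :: "('p::{finite,linorder}, 'x) ppinst \<Rightarrow> bool list" where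
  "inst_code I = enc_nat (length (ineqs I)) @ concat (map enc_point (ineqs I)) @ impl_code I"

definition inst_length :: "('p::{finite,linorder}, 'x) ppinst \<Rightarrow> nat" where
  "inst_length I = length (inst_code I)"

definition obj_val :: "('p::finite, 'x) ppinst \<Rightarrow> (real, 'p) vec \<Rightarrow> 'x \<Rightarrow> real" where
  "obj_val I lam x = (\<Sum>i\<in>UNIV. lam $ i * fst (objs I x) $ i) + snd (objs I x)"

definition opt_val :: "('p::finite, 'x) ppinst \<Rightarrow> (real, 'p) vec \<Rightarrow> real" where
  "opt_val I lam = (INF x\<in>sols I. obj_val I lam x)"

definition no_redundant_ineqs :: "('p::finite, 'x) ppinst \<Rightarrow> bool" where
  "no_redundant_ineqs I \<longleftrightarrow>
    (\<forall>k < length (ineqs I).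
       {lam. \<forall>i < length (ineqs I). i \<noteq> k \<longrightarrow> satisfies lam (ineqs I ! i)} \<noteq> params I)"

definition polytime_objs :: "('p::{finite,linorder}, 'x) ppinst set \<Rightarrow> bool" where
  "polytime_objs Prob \<longleftrightarrow>
    (\<exists>(M :: machine) (T :: nat poly). finite (dom M) \<and>
      (\<forall>I\<in>Prob. \<forall>x\<in>sols I. \<exists>y. objs I x = real_point y \<and>
         (let input = delimit (inst_code I) @ sol_code I x
          in computes_within M (poly T (length input)) input (enc_point y))))"

text \<open>The polynomial \<open>\<beta>\<close> is the fixed bound on the encoding length of solutions.\<close>

definition short_sols :: "nat poly \<Rightarrow> ('p::{finite,linorder}, 'x) ppinst \<Rightarrow> 'x set" where
  "short_sols \<beta> I = {x \<in> sols I. length (sol_code I x) \<le> poly \<beta> (inst_length I)}"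

locale parametric_problem =
  fixes Prob :: "('p::{finite,linorder}, 'x) ppinst set"
    and \<beta> :: "nat poly"
  assumes ineqs_nonempty: "I \<in> Prob \<Longrightarrow> ineqs I \<noteq> []"
    and sol_code_inj: "I \<in> Prob \<Longrightarrow> inj_on (sol_code I) (sols I)"
    and polytime: "polytime_objs Prob"
    and bounded: "I \<in> Prob \<Longrightarrow> lam \<in> params I \<Longrightarrow> bdd_below (obj_val I lam ` sols I)"
    and short_optimum: "I \<in> Prob \<Longrightarrow> lam \<in> params I \<Longrightarrow>
          \<exists>x\<in>short_sols \<beta> I. is_arg_min (obj_val I lam) (\<lambda>y. y \<in> sols I) x"
    and full_dim: "I \<in> Prob \<Longrightarrow> aff_dim (params I) = int CARD('p)"
    and irredundant: "I \<in> Prob \<Longrightarrow> no_redundant_ineqs I"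
    and nonneg: "I \<in> Prob \<Longrightarrow> lam \<in> params I \<Longrightarrow> x \<in> sols I \<Longrightarrow> obj_val I lam x \<ge> 0"

definition approx_alg ::
  "nat poly \<Rightarrow> real \<Rightarrow> ('p::{finite,linorder}, 'x) ppinst \<Rightarrow> ((real, 'p) vec \<Rightarrow> 'x) \<Rightarrow> bool" where
  "approx_alg \<beta> \<alpha> I Alg \<longleftrightarrow>
    (\<forall>lam\<in>params I. Alg lam \<in> short_sols \<beta> I \<and> obj_val I lam (Alg lam) \<le> \<alpha> * opt_val I lam)"


section \<open>The algorithm\<close>

definition below :: "('p::finite, 'x) ppinst \<Rightarrow> 'x \<Rightarrow> ((real, 'p) vec \<times> real) set" where
  "below I x = {(lam, z). z \<le> obj_val I lam x}"

definition below_all :: "('p::finite, 'x) ppinst \<Rightarrow> 'x set \<Rightarrow> ((real, 'p) vec \<times> real) set" where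
  "below_all I S = (\<Inter>x\<in>S. below I x) \<inter> (params I \<times> UNIV)"

definition vert :: "'a::real_vector set \<Rightarrow> 'a set" where
  "vert P = {v. v extreme_point_of P}"

text \<open>
  \<open>run I \<epsilon> Alg V S W\<close> means that the algorithm can reach a state with queried parameters \<open>V\<close>,
  solution set \<open>S\<close>, and set \<open>W\<close> of vertices that the current loop still has to process. The initial
  parameter and the order in which vertices are processed are arbitrary. Adding a solution aborts the
  loop and restarts it with the vertices of the new polyhedron.
\<close>

inductive run ::
  "('p::finite, 'x) ppinst \<Rightarrow> real \<Rightarrow> ((real, 'p) vec \<Rightarrow> 'x) \<Rightarrow>
   (real, 'p) vec set \<Rightarrow> 'x set \<Rightarrow> ((real, 'p) vec \<times> real) set \<Rightarrow> bool"
  for I \<epsilon> Alg where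
  init: "lam0 \<in> params I \<Longrightarrow> run I \<epsilon> Alg {lam0} {Alg lam0} (vert (below_all I {Alg lam0}))"
| skip: "run I \<epsilon> Alg V S W \<Longrightarrow> (lam, z) \<in> W \<Longrightarrow> lam \<in> V \<Longrightarrow> run I \<epsilon> Alg V S (W - {(lam, z)})"
| keep: "run I \<epsilon> Alg V S W \<Longrightarrow> (lam, z) \<in> W \<Longrightarrow> lam \<notin> V \<Longrightarrow>
    \<not> (1 + \<epsilon>) * obj_val I lam (Alg lam) < z \<Longrightarrow> run I \<epsilon> Alg (insert lam V) S (W - {(lam, z)})"
| extend: "run I \<epsilon> Alg V S W \<Longrightarrow> (lam, z) \<in> W \<Longrightarrow> lam \<notin> V \<Longrightarrow>
    (1 + \<epsilon>) * obj_val I lam (Alg lam) < z \<Longrightarrow>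
    run I \<epsilon> Alg (insert lam V) (insert (Alg lam) S) (vert (below_all I (insert (Alg lam) S)))"

text \<open>\<open>S\<close> is a possible solution set at the end of the loop, before redundant solutions are removed.\<close>

definition final_set ::
  "('p::finite, 'x) ppinst \<Rightarrow> real \<Rightarrow> ((real, 'p) vec \<Rightarrow> 'x) \<Rightarrow> 'x set \<Rightarrow> bool" where
  "final_set I \<epsilon> Alg S \<longleftrightarrow> (\<exists>V. run I \<epsilon> Alg V S {})"

definition poly2 :: "real poly poly \<Rightarrow> real \<Rightarrow> real \<Rightarrow> real" where
  "poly2 R a b = poly (poly R [:b:]) a"

end

theory Submission
  imports Defs
begin

text \<open>
  Suppose the algorithm adds \<open>x\<close> at the vertex \<open>(\<lambda>, z)\<close>. Every earlier \<open>y\<close> satisfies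
  \<open>F\<^sub>\<lambda> y \<ge> z > (1 + \<epsilon>) F\<^sub>\<lambda> x\<close>, so no earlier solution is within a factor \<open>1 + \<epsilon>\<close> of \<open>x\<close> at \<open>\<lambda>\<close>. The
  bound comes from a discretisation of the solutions that such a pair cannot share.

  By Caratheodory's theorem \<open>\<lambda>\<close> lies in the convex hull of \<open>p + 1\<close> vertices of \<open>\<Lambda>\<close>
  (\<open>polytope_vertex_list\<close>). The maps \<open>\<lambda> \<mapsto> F\<^sub>\<lambda> x\<close> are affine, so if \<open>F y \<le> (1 + \<epsilon>) F x\<close> holds at these
  \<open>p + 1\<close> vertices, it holds at \<open>\<lambda>\<close>. Let the grade of a nonnegative value be its cell in the
  geometric grid with ratio \<open>1 + \<epsilon>\<close>, where zero is a cell of its own. Then \<open>x\<close> and \<open>y\<close> cannot have the same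
  grades at all of these vertices (\<open>same_profile_le\<close>). Consequently the map that sends \<open>x\<close> to the
  list of its \<open>p + 1\<close> vertices, together with the grades of \<open>x\<close> there, is injective on the solution
  set (\<open>run_distinct_profiles\<close>), and it remains to count these lists.

  Each vertex of \<open>\<Lambda>\<close> is the unique solution of \<open>p\<close> of the \<open>m\<close> inequalities taken as equations, so
  there are at most \<open>m\<^sup>p\<close> vertices (\<open>card_vert_params\<close>). Cramer's rule and the polynomial
  running time of the objectives bound the numerator and denominator of \<open>F\<^sub>v x\<close> at a vertex \<open>v\<close> by
  \<open>2\<^sup>N\<close>, where \<open>N\<close> is polynomial in \<open>\<langle>\<Pi>\<rangle>\<close> (\<open>vertex_obj_val_size\<close>). A positive value thus lies in
  \<open>[2\<^sup>-\<^sup>N, 2\<^sup>N]\<close>, which meets \<open>O(1 + N / ln (1 + \<epsilon>))\<close> cells, and \<open>1 / ln (1 + \<epsilon>) \<le> 1 + 1 / \<epsilon>\<close>. There are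
  hence at most \<open>(m\<^sup>p \<cdot> O(N (1 + 1 / \<epsilon>) + 1))\<^sup>p\<^sup>+\<^sup>1\<close> lists (\<open>card_final_set\<close>). Since
  \<open>1 \<le> m \<le> \<langle>\<Pi>\<rangle>\<close>, the base is bounded by a polynomial in \<open>\<langle>\<Pi>\<rangle>\<close> and \<open>1 / \<epsilon>\<close>, and the explicit
  power of \<open>m\<close> in the theorem is at least \<open>1\<close>.
\<close>

section \<open>Rational numbers of bounded size\<close>

text \<open>
  The fraction need not be in lowest terms and the denominator may be negative. This makes the
  predicate closed under field operations by the schoolbook formulas, and symmetric under inversion,
  so an upper bound on all numbers of size \<open>k\<close> is also a lower bound on the positive ones.
\<close>

definition has_size :: "nat \<Rightarrow> real \<Rightarrow> bool" where
  "has_size k w \<longleftrightarrow> (\<exists>a b :: int. w = real_of_int a / real_of_int b \<and> b \<noteq> 0 \<and> \<bar>a\<bar> \<le> 2 ^ k \<and> \<bar>b\<bar> \<le> 2 ^ k)"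

lemma has_size_mono:
  assumes "has_size k w" "k \<le> l"
  shows "has_size l w"
proof -
  have "(2::int) ^ k \<le> 2 ^ l" using assms(2) by simp
  then have "c \<le> 2 ^ l" if "c \<le> 2 ^ k" for c :: int using that by linarith
  moreover obtain a b :: int where "w = real_of_int a / real_of_int b" "b \<noteq> 0" "\<bar>a\<bar> \<le> 2 ^ k" "\<bar>b\<bar> \<le> 2 ^ k"
    using assms(1) unfolding has_size_def by blast
  ultimately show ?thesis unfolding has_size_def by blast
qed

lemma has_size_mult:
  assumes "has_size k v" "has_size l w"
  shows "has_size (k + l) (v * w)"
proof -
  obtain a b c d :: int where v: "v = real_of_int a / real_of_int b" "b \<noteq> 0" "\<bar>a\<bar> \<le> 2 ^ k" "\<bar>b\<bar> \<le> 2 ^ k"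
    and w: "w = real_of_int c / real_of_int d" "d \<noteq> 0" "\<bar>c\<bar> \<le> 2 ^ l" "\<bar>d\<bar> \<le> 2 ^ l"
    using assms unfolding has_size_def by blast
  have "v * w = real_of_int (a * c) / real_of_int (b * d)" using v w by simp
  moreover have "\<bar>a * c\<bar> \<le> 2 ^ (k + l)" "\<bar>b * d\<bar> \<le> 2 ^ (k + l)"
    using v w by (simp_all add: abs_mult power_add mult_mono)
  ultimately show ?thesis unfolding has_size_def using v w by (metis mult_eq_0_iff)
qed

lemma has_size_add:
  assumes "has_size k v" "has_size l w"
  shows "has_size (k + l + 1) (v + w)"
proof -
  obtain a b c d :: int where v: "v = real_of_int a / real_of_int b" "b \<noteq> 0" "\<bar>a\<bar> \<le> 2 ^ k" "\<bar>b\<bar> \<le> 2 ^ k"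
    and w: "w = real_of_int c / real_of_int d" "d \<noteq> 0" "\<bar>c\<bar> \<le> 2 ^ l" "\<bar>d\<bar> \<le> 2 ^ l"
    using assms unfolding has_size_def by blast
  have "v + w = real_of_int (a * d + c * b) / real_of_int (b * d)"
    using v w by (simp add: field_simps)
  moreover have ad: "\<bar>a * d\<bar> \<le> 2 ^ (k + l)" and cb: "\<bar>c * b\<bar> \<le> 2 ^ (k + l)" and bd: "\<bar>b * d\<bar> \<le> 2 ^ (k + l)"
    using v w mult_mono[of "\<bar>c\<bar>" "2 ^ l" "\<bar>b\<bar>" "2 ^ k"]
    by (simp_all add: abs_mult power_add mult_mono mult.commute)
  have "\<bar>a * d + c * b\<bar> \<le> 2 ^ (k + l + 1)" using ad cb by simp
  moreover have "\<bar>b * d\<bar> \<le> 2 ^ (k + l + 1)" using bd by simp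
  ultimately show ?thesis unfolding has_size_def using v w by (metis mult_eq_0_iff)
qed

lemma has_size_of_int: "\<bar>a\<bar> \<le> 1 \<Longrightarrow> has_size 0 (real_of_int a)"
  unfolding has_size_def by (intro exI[of _ a] exI[of _ 1]) simp

lemma has_size_inverse:
  assumes "has_size k w"
  shows "has_size k (inverse w)"
proof (cases "w = 0")
  case True
  then show ?thesis using assms by simp
next
  case False
  obtain a b :: int where v: "w = real_of_int a / real_of_int b" "b \<noteq> 0" "\<bar>a\<bar> \<le> 2 ^ k" "\<bar>b\<bar> \<le> 2 ^ k"
    using assms unfolding has_size_def by blast
  then have "a \<noteq> 0" using False by auto
  moreover have "inverse w = real_of_int b / real_of_int a" using v by simp
  ultimately show ?thesis unfolding has_size_def using v by blast
qed

lemma has_size_divide: "has_size k v \<Longrightarrow> has_size l w \<Longrightarrow> has_size (k + l) (v / w)"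
  unfolding divide_inverse by (intro has_size_mult has_size_inverse)

lemma has_size_sum:
  assumes "finite A" "\<And>i. i \<in> A \<Longrightarrow> has_size k (g i)"
  shows "has_size (card A * (k + 1)) (sum g A)"
  using assms
proof (induction rule: finite_induct)
  case empty
  then show ?case using has_size_of_int[of 0] by simp
next
  case (insert i A)
  have "has_size (k + card A * (k + 1) + 1) (g i + sum g A)"
    using insert by (intro has_size_add) auto
  then show ?case using insert by (simp add: algebra_simps)
qed

lemma has_size_prod:
  assumes "finite A" "\<And>i. i \<in> A \<Longrightarrow> has_size k (g i)"
  shows "has_size (card A * k) (prod g A)"
  using assms
proof (induction rule: finite_induct)
  case empty
  then show ?case using has_size_of_int[of 1] by simp
next
  case (insert i A)
  have "has_size (k + card A * k) (g i * prod g A)"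
    using insert by (intro has_size_mult) auto
  then show ?case using insert by (simp add: algebra_simps)
qed

text \<open>
  The Leibniz sum has \<open>n!\<close> terms, so the factor in front of \<open>k\<close> is exponential in the dimension. The
  dimension is a constant here, and what counts is that the bound is linear in \<open>k\<close>.
\<close>

lemma has_size_det:
  fixes A :: "real ^ 'n ^ 'n"
  assumes "\<And>i j. has_size k (A $ i $ j)"
  shows "has_size (fact CARD('n) * (CARD('n) * k + 1)) (det A)"
proof -
  have "has_size (0 + CARD('n) * k) (of_int (sign p) * (\<Prod>i\<in>UNIV. A $ i $ p i))" for p
    by (intro has_size_mult has_size_of_int has_size_prod assms) (auto simp: sign_def)
  then have "has_size (card {p. p permutes (UNIV :: 'n set)} * (0 + CARD('n) * k + 1)) (det A)"
    unfolding det_def by (intro has_size_sum finite_permutations) auto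
  then show ?thesis by (simp add: card_permutations)
qed

lemma has_size_bounds:
  assumes "has_size k w" "w > 0"
  shows "w \<le> 2 ^ k" "1 / 2 ^ k \<le> w"
proof -
  have upper: "v \<le> 2 ^ k" if size: "has_size k v" for v
  proof -
    obtain a b :: int where v: "v = real_of_int a / real_of_int b" "b \<noteq> 0" "\<bar>a\<bar> \<le> 2 ^ k"
      using size unfolding has_size_def by blast
    have "\<bar>v\<bar> = real_of_int \<bar>a\<bar> / real_of_int \<bar>b\<bar>" using v by simp
    also have "\<dots> \<le> real_of_int \<bar>a\<bar> / 1"
    proof (rule divide_left_mono)
      have "1 \<le> \<bar>b\<bar>" using v(2) by linarith
      then show "1 \<le> real_of_int \<bar>b\<bar>" by linarith
    qed (use v(2) in auto)
    also have "real_of_int \<bar>a\<bar> \<le> real_of_int (2 ^ k)" using v(3) by (simp only: of_int_le_iff)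
    finally show ?thesis by simp
  qed
  show "w \<le> 2 ^ k" by (rule upper[OF assms(1)])
  have "inverse w \<le> 2 ^ k" by (intro upper has_size_inverse assms)
  then show "1 / 2 ^ k \<le> w" using assms(2) by (simp add: field_simps)
qed

section \<open>Encoding lengths\<close>

lemma less_two_power_nat_bits: "n < 2 ^ length (nat_bits n)"
proof (induction n rule: nat_bits.induct)
  case (1 n)
  then show ?case
    by (subst nat_bits.simps) (cases "n = 0", auto)
qed

lemma length_delimit: "length (delimit w) = 2 * length w + 1"
  by (induction w) (auto simp: delimit_def)

lemma has_size_enc_rat: "has_size (length (enc_rat r)) (real_of_rat r)"
proof -
  obtain a b where q: "quotient_of r = (a, b)" by force
  then have b: "b > 0" and r: "r = of_int a / of_int b"
    using quotient_of_denom_pos quotient_of_div by auto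
  have le: "length (nat_bits (nat \<bar>a\<bar>)) \<le> length (enc_rat r)" "length (nat_bits (nat b)) \<le> length (enc_rat r)"
    by (simp_all add: enc_rat_def q enc_int_def enc_nat_def length_delimit)
  have bd: "\<bar>c\<bar> \<le> 2 ^ l" if "length (nat_bits (nat \<bar>c\<bar>)) \<le> l" for c :: int and l
  proof -
    have "nat \<bar>c\<bar> < 2 ^ length (nat_bits (nat \<bar>c\<bar>))" by (rule less_two_power_nat_bits)
    also have "\<dots> \<le> 2 ^ l" using that by simp
    finally show ?thesis by (simp add: nat_less_iff)
  qed
  show ?thesis unfolding has_size_def
    using b bd[OF le(1)] bd[of b] le(2)
    by (intro exI[of _ a] exI[of _ b]) (auto simp: r of_rat_divide)
qed

lemma length_le_length_concat: "x \<in> set xs \<Longrightarrow> length (g x) \<le> length (concat (map g xs))"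
  by (induction xs) auto

lemma has_size_enc_point:
  assumes "length (enc_point u) \<le> k"
  shows "has_size k (fst (real_point u) $ i)" "has_size k (snd (real_point u))"
proof -
  have "length (enc_rat (fst u $ i)) \<le> length (enc_vec (fst u))"
    unfolding enc_vec_def by (rule length_le_length_concat) simp
  then have "length (enc_rat (fst u $ i)) \<le> k" using assms by (simp add: enc_point_def)
  then show "has_size k (fst (real_point u) $ i)"
    by (simp add: real_point_def real_vec_def has_size_mono[OF has_size_enc_rat])
  have "length (enc_rat (snd u)) \<le> k" using assms by (simp add: enc_point_def)
  then show "has_size k (snd (real_point u))"
    by (simp add: real_point_def has_size_mono[OF has_size_enc_rat])
qed

lemma length_enc_point_le_inst_length:
  "c \<in> set (ineqs I) \<Longrightarrow> length (enc_point c) \<le> inst_length I"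
  using length_le_length_concat[of c "ineqs I" enc_point] by (simp add: inst_length_def inst_code_def)

lemma length_ineqs_le_inst_length:
  fixes I :: "('p::{finite,linorder}, 'x) ppinst"
  shows "length (ineqs I) \<le> inst_length I"
proof -
  have "length cs \<le> length (concat (map enc_point cs))" for cs :: "((rat, 'p) vec \<times> rat) list"
  proof (induction cs)
    case (Cons c cs)
    have "length (enc_point c) \<ge> 1"
      by (simp add: enc_point_def enc_rat_def enc_nat_def length_delimit split: prod.splits)
    then show ?case using Cons by simp
  qed simp
  from this[of "ineqs I"] show ?thesis by (simp add: inst_length_def inst_code_def)
qed

text \<open>
  A step to the left from an exhausted right half \<open>[]\<close> creates two cells, the scanned one and the
  one written; this is why the growth per step is bounded by \<open>2\<close>.
\<close>

lemma length_tm_steps: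
  "(tm_step M ^^ t) (q0, l0, r0) = (q, l, r) \<Longrightarrow> length r \<le> length r0 + 2 * t"
proof (induction t arbitrary: q l r)
  case (Suc t)
  obtain q' l' r' where s: "(tm_step M ^^ t) (q0, l0, r0) = (q', l', r')"
    by (metis prod_cases3)
  have "tm_step M (q', l', r') = (q, l, r)" using Suc.prems s by simp
  then have "length r \<le> length r' + 2"
    by (auto split: option.splits move.splits)
  then show ?case using Suc.IH[OF s] by simp
qed simp

lemma computes_within_length:
  assumes "computes_within M t u v"
  shows "length v \<le> length u + 2 * t"
proof -
  obtain q l r where r: "(tm_step M ^^ t) (0, [], map bit_symbol u) = (q, l, r)"
    and v: "takeWhile (\<lambda>s. s \<noteq> 0) r = map bit_symbol v"
    using assms unfolding computes_within_def by blast
  have "length v = length (takeWhile (\<lambda>s. s \<noteq> 0) r)" unfolding v by simp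
  also have "\<dots> \<le> length r" by (rule length_takeWhile_le)
  also have "\<dots> \<le> length u + 2 * t" using length_tm_steps[OF r] by simp
  finally show ?thesis .
qed

lemma poly_nat_mono:
  fixes T :: "nat poly"
  assumes "a \<le> b"
  shows "poly T a \<le> poly T b"
  using assms by (induction T) (auto intro!: mult_mono)

lemma poly_map_poly_real: "poly (map_poly real T) (real n) = real (poly T n)"
  by (induction T) (auto simp: map_poly_pCons)

text \<open>
  A machine writes at most linearly many symbols in its running time, so the objective values of a
  solution of polynomial length have polynomially many bits.
\<close>

lemma short_sols_objs_size:
  fixes Prob :: "('p::{finite,linorder}, 'x) ppinst set"
  assumes "polytime_objs Prob"
  obtains E :: "nat poly" where
    "\<And>I x i. I \<in> Prob \<Longrightarrow> x \<in> short_sols \<beta> I \<Longrightarrow> has_size (poly E (inst_length I)) (fst (objs I x) $ i)"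
    "\<And>I x. I \<in> Prob \<Longrightarrow> x \<in> short_sols \<beta> I \<Longrightarrow> has_size (poly E (inst_length I)) (snd (objs I x))"
proof -
  obtain M T where MT: "\<And>I x. I \<in> Prob \<Longrightarrow> x \<in> sols I \<Longrightarrow> \<exists>y. objs I x = real_point y \<and>
      (let input = delimit (inst_code I) @ sol_code I x
       in computes_within M (poly T (length input)) input (enc_point y))"
    using assms unfolding polytime_objs_def by metis
  (* U bounds the length of the machine input: the delimiter doubles the instance code. *)
  define U :: "nat poly" where "U = [:1, 2:] + \<beta>"
  define E where "E = U + 2 * pcompose T U"
  have "\<exists>y. objs I x = real_point y \<and> length (enc_point y) \<le> poly E (inst_length I)"
    if I: "I \<in> Prob" and x: "x \<in> short_sols \<beta> I" for I x
  proof -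
    let ?input = "delimit (inst_code I) @ sol_code I x"
    have "x \<in> sols I" using x by (simp add: short_sols_def)
    from MT[OF I this] obtain y where y: "objs I x = real_point y"
      "computes_within M (poly T (length ?input)) ?input (enc_point y)"
      unfolding Let_def by blast
    have len: "length ?input \<le> poly U (inst_length I)"
      using x by (simp add: short_sols_def U_def length_delimit inst_length_def mult.commute)
    have "length (enc_point y) \<le> length ?input + 2 * poly T (length ?input)"
      by (rule computes_within_length[OF y(2)])
    also have "\<dots> \<le> poly E (inst_length I)"
      using len poly_nat_mono[OF len, of T] by (simp add: E_def poly_pcompose)
    finally show ?thesis using y(1) by blast
  qed
  then show thesis by (intro that[of E]; metis has_size_enc_point)
qed

section \<open>Vertices of the parameter polytope\<close>

text \<open>Cramer's formula for the point at which the inequalities \<open>g i\<close> are all tight.\<close>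

definition tight_point :: "('p::finite \<Rightarrow> (rat, 'p) vec \<times> rat) \<Rightarrow> (real, 'p) vec" where
  "tight_point g =
    (\<chi> k. det (\<chi> i j. if j = k then real_of_rat (snd (g i)) else real_vec (fst (g i)) $ j) /
         det (\<chi> i j. real_vec (fst (g i)) $ j))"

text \<open>
  If the tight rows at \<open>v\<close> did not span the space, there would be a direction \<open>u\<close> orthogonal to all of them.
  Moving from \<open>v\<close> a little along \<open>u\<close> or \<open>- u\<close> keeps the tight inequalities tight and does not use up the
  slack of the others, so \<open>v\<close> would be the midpoint of a segment in the polyhedron.
\<close>

lemma tight_rows_span:
  fixes v :: "'a::euclidean_space"
  assumes fin: "finite C" and v: "v extreme_point_of {y. \<forall>c\<in>C. r c \<bullet> y \<ge> d c}"
  shows "span (r ` {c\<in>C. r c \<bullet> v = d c}) = UNIV"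
proof (rule ccontr)
  let ?P = "{y. \<forall>c\<in>C. r c \<bullet> y \<ge> d c}"
  let ?T = "{c\<in>C. r c \<bullet> v = d c}"
  assume "span (r ` ?T) \<noteq> UNIV"
  then have "dim (r ` ?T) < DIM('a)"
    by (metis dim_eq_full dim_subset_UNIV order_le_less)
  from orthogonal_to_subspace_exists[OF this] obtain u where u: "u \<noteq> 0"
    and orth: "\<And>y. y \<in> span (r ` ?T) \<Longrightarrow> orthogonal u y" by metis
  have "v \<in> ?P" using v unfolding extreme_point_of_def by blast
  then have feas: "r c \<bullet> v \<ge> d c" if "c \<in> C" for c using that by blast
  have "\<exists>t>0. \<forall>c\<in>C. \<forall>s. \<bar>s\<bar> \<le> t \<longrightarrow> r c \<bullet> (v + s *\<^sub>R u) \<ge> d c"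
  proof -
    (* The 1 in the denominators guards against division by zero, the inserted 1 against an
       empty minimum. *)
    define t where "t = Min (insert 1 ((\<lambda>c. (r c \<bullet> v - d c) / (1 + \<bar>r c \<bullet> u\<bar>)) ` (C - ?T)))"
    have "t > 0" unfolding t_def using fin feas
      by (subst Min_gr_iff) (auto intro!: divide_pos_pos simp: order_less_le)
    moreover have "r c \<bullet> (v + s *\<^sub>R u) \<ge> d c" if c: "c \<in> C" and s: "\<bar>s\<bar> \<le> t" for c s
    proof (cases "c \<in> ?T")
      case True
      then have "orthogonal u (r c)" by (intro orth span_base) auto
      then show ?thesis using True by (simp add: orthogonal_def inner_commute inner_add_right)
    next
      case False
      then have "t \<le> (r c \<bullet> v - d c) / (1 + \<bar>r c \<bullet> u\<bar>)"
        unfolding t_def using c fin by (intro Min_le) auto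
      then have "t * (1 + \<bar>r c \<bullet> u\<bar>) \<le> r c \<bullet> v - d c" by (simp add: field_simps)
      moreover have "\<bar>s * (r c \<bullet> u)\<bar> \<le> t * (1 + \<bar>r c \<bullet> u\<bar>)"
        using s \<open>t > 0\<close> by (auto simp: abs_mult intro!: mult_mono)
      ultimately have "- (s * (r c \<bullet> u)) \<le> r c \<bullet> v - d c" by linarith
      then show ?thesis by (simp add: inner_add_right)
    qed
    ultimately show ?thesis by blast
  qed
  then obtain t where t: "t > 0" "\<And>c s. c \<in> C \<Longrightarrow> \<bar>s\<bar> \<le> t \<Longrightarrow> r c \<bullet> (v + s *\<^sub>R u) \<ge> d c"
    by blast
  have "v + t *\<^sub>R u \<in> ?P" "v + (- t) *\<^sub>R u \<in> ?P" using t by (auto simp del: scaleR_minus_left)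
  moreover have "v \<in> open_segment (v + t *\<^sub>R u) (v + (- t) *\<^sub>R u)"
  proof -
    have "midpoint (v + t *\<^sub>R u) (v + (- t) *\<^sub>R u) = v"
      by (simp add: midpoint_def scaleR_2[symmetric])
    moreover have "v + t *\<^sub>R u \<noteq> v + (- t) *\<^sub>R u"
    proof
      assume "v + t *\<^sub>R u = v + (- t) *\<^sub>R u"
      then have "(2 * t) *\<^sub>R u = 0" by (simp add: algebra_simps scaleR_2[symmetric] flip: scaleR_scaleR)
      then show False using u t(1) by simp
    qed
    ultimately show ?thesis using midpoint_in_open_segment by metis
  qed
  ultimately show False using v unfolding extreme_point_of_def by blast
qed

lemma extreme_point_is_tight_point:
  fixes v :: "(real, 'p::finite) vec" and C :: "((rat, 'p) vec \<times> rat) set"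
  assumes "finite C" "v extreme_point_of {y. \<forall>c\<in>C. satisfies y c}"
  shows "\<exists>g. range g \<subseteq> C \<and> v = tight_point g"
proof -
  let ?r = "\<lambda>c :: (rat, 'p) vec \<times> rat. real_vec (fst c)"
  let ?T = "{c\<in>C. ?r c \<bullet> v = real_of_rat (snd c)}"
  have span: "span (?r ` ?T) = UNIV"
    using assms unfolding satisfies_def by (intro tight_rows_span) auto
  obtain B where B: "B \<subseteq> ?r ` ?T" "independent B" "?r ` ?T \<subseteq> span B"
    using maximal_independent_subset[of "?r ` ?T"] by auto
  have spanB: "span B = UNIV" using span_minimal[OF B(3) subspace_span] span by auto
  have "finite B" using B(2) by (rule independent_imp_finite)
  have "card B = dim B" by (rule dim_eq_card_independent[OF B(2), symmetric])
  also have "\<dots> = CARD('p)" using dim_span[of B] by (simp add: spanB)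
  finally obtain h :: "'p \<Rightarrow> _" where h: "bij_betw h UNIV B"
    using finite_same_card_bij[OF finite \<open>finite B\<close>] by metis
  have "\<forall>i. \<exists>c. c \<in> ?T \<and> ?r c = h i"
  proof
    fix i
    have "h i \<in> ?r ` ?T" using B(1) bij_betwE[OF h] by blast
    then show "\<exists>c. c \<in> ?T \<and> ?r c = h i" by force
  qed
  from choice[OF this] obtain g where g: "\<And>i. g i \<in> ?T" "\<And>i. ?r (g i) = h i" by blast
  let ?A = "\<chi> i j. ?r (g i) $ j"
  have "row i ?A = h i" for i by (simp add: row_def g(2) vec_eq_iff)
  then have "rows ?A = B" using h by (auto simp: rows_def bij_betw_def)
  then have "invertible ?A"
    unfolding invertible_left_inverse matrix_left_invertible_span_rows by (simp only: spanB)
  then have det: "det ?A \<noteq> 0" by (simp add: invertible_det_nz)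
  have "?A *v v = (\<chi> i. real_of_rat (snd (g i)))"
    using g(1) by (simp add: vec_eq_iff matrix_vector_mult_def inner_vec_def)
  then have "v = tight_point g"
    unfolding cramer[OF det] tight_point_def vec_lambda_beta .
  moreover have "range g \<subseteq> C" using g(1) by auto
  ultimately show ?thesis by blast
qed

lemma params_eq: "params I = {y. \<forall>c\<in>set (ineqs I). satisfies y c}"
  unfolding params_def by (auto simp: all_set_conv_all_nth)

text \<open>The \<open>p\<close> tight inequalities determine the vertex, so vertices are at most as many as choices.\<close>

lemma card_vert_params:
  fixes I :: "('p::finite, 'x) ppinst"
  shows "finite (vert (params I))" "card (vert (params I)) \<le> length (ineqs I) ^ CARD('p)"
proof -
  let ?G = "UNIV \<rightarrow>\<^sub>E set (ineqs I) :: ('p \<Rightarrow> _) set"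
  have fin: "finite ?G" by (intro finite_PiE) auto
  have sub: "vert (params I) \<subseteq> tight_point ` ?G"
  proof
    fix v assume "v \<in> vert (params I)"
    then obtain g where "range g \<subseteq> set (ineqs I)" "v = tight_point g"
      using extreme_point_is_tight_point[of "set (ineqs I)" v] by (auto simp: vert_def params_eq)
    then show "v \<in> tight_point ` ?G" by auto
  qed
  show "finite (vert (params I))" using finite_subset[OF sub] fin by blast
  have "card (vert (params I)) \<le> card (tight_point ` ?G)" using fin by (intro card_mono sub) auto
  also have "\<dots> \<le> card ?G" by (rule card_image_le[OF fin])
  also have "\<dots> = card (set (ineqs I)) ^ CARD('p)" by (simp add: card_funcsetE)
  also have "\<dots> \<le> length (ineqs I) ^ CARD('p)" by (intro power_mono card_length) simp
  finally show "card (vert (params I)) \<le> length (ineqs I) ^ CARD('p)" .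
qed

lemma has_size_tight_point:
  fixes g :: "'p::finite \<Rightarrow> (rat, 'p) vec \<times> rat"
  assumes "\<And>i j. has_size k (fst (real_point (g i)) $ j)" "\<And>i. has_size k (snd (real_point (g i)))"
  shows "has_size (2 * (fact CARD('p) * (CARD('p) * k + 1))) (tight_point g $ j)"
proof -
  have row: "has_size k (real_vec (fst (g i)) $ l)" and rhs: "has_size k (real_of_rat (snd (g i)))" for i l
    using assms by (simp_all add: real_point_def)
  show ?thesis
    unfolding tight_point_def mult_2 vec_lambda_beta
    by (intro has_size_divide has_size_det) (simp_all add: row rhs)
qed

lemma vertex_obj_val_size:
  fixes Prob :: "('p::{finite,linorder}, 'x) ppinst set"
  assumes "polytime_objs Prob"
  obtains N :: "nat poly" where
    "\<And>I x v. I \<in> Prob \<Longrightarrow> x \<in> short_sols \<beta> I \<Longrightarrow> v \<in> vert (params I) \<Longrightarrow>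
       has_size (poly N (inst_length I)) (obj_val I v x)"
proof -
  obtain E :: "nat poly" where
    E: "\<And>I x i. I \<in> Prob \<Longrightarrow> x \<in> short_sols \<beta> I \<Longrightarrow> has_size (poly E (inst_length I)) (fst (objs I x) $ i)"
      "\<And>I x. I \<in> Prob \<Longrightarrow> x \<in> short_sols \<beta> I \<Longrightarrow> has_size (poly E (inst_length I)) (snd (objs I x))"
    using short_sols_objs_size[OF assms, where \<beta> = \<beta>] by blast
  let ?p = "of_nat CARD('p) :: nat poly"
  define D :: "nat poly" where "D = 2 * (of_nat (fact CARD('p)) * (?p * [:0, 1:] + 1))"
  define N where "N = ?p * (D + E + 1) + E + 1"
  have "has_size (poly N (inst_length I)) (obj_val I v x)"
    if I: "I \<in> Prob" and x: "x \<in> short_sols \<beta> I" and v: "v \<in> vert (params I)" for I x v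
  proof -
    let ?L = "inst_length I"
    obtain g where g: "range g \<subseteq> set (ineqs I)" "v = tight_point g"
      using extreme_point_is_tight_point[of "set (ineqs I)" v] v by (auto simp: vert_def params_eq)
    have "length (enc_point (g i)) \<le> ?L" for i
      using g(1) by (intro length_enc_point_le_inst_length) auto
    then have "has_size (2 * (fact CARD('p) * (CARD('p) * ?L + 1))) (tight_point g $ i)" for i
      by (intro has_size_tight_point has_size_enc_point)
    then have "has_size (poly D ?L) (v $ i)" for i
      unfolding g(2) by (simp add: D_def mult.commute)
    then have "has_size (CARD('p) * (poly D ?L + poly E ?L + 1) + poly E ?L + 1) (obj_val I v x)"
      unfolding obj_val_def by (intro has_size_add has_size_sum has_size_mult E I x) auto
    then show ?thesis by (simp add: N_def)
  qed
  then show thesis by (rule that)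
qed

section \<open>Geometric grid\<close>

text \<open>
  The first component gives the value zero a cell of its own: \<open>log\<close> maps it to the default \<open>0\<close>, which
  is also the logarithm of \<open>1\<close>.
\<close>

definition grade :: "real \<Rightarrow> real \<Rightarrow> bool \<times> int" where
  "grade \<epsilon> w = (w = 0, \<lfloor>log (1 + \<epsilon>) w\<rfloor>)"

lemma same_grade_le:
  assumes "\<epsilon> > 0" "w \<ge> 0" "w' \<ge> 0" "grade \<epsilon> w = grade \<epsilon> w'"
  shows "w \<le> (1 + \<epsilon>) * w'"
proof (cases "w = 0")
  case True
  then show ?thesis using assms by simp
next
  case False
  then have pos: "w > 0" "w' > 0" using assms by (auto simp: grade_def)
  have "log (1 + \<epsilon>) w \<le> 1 + log (1 + \<epsilon>) w'"
    using assms(4) unfolding grade_def by (simp, linarith)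
  also have "\<dots> = log (1 + \<epsilon>) ((1 + \<epsilon>) * w')" using pos assms(1) by (simp add: log_mult)
  finally show ?thesis using pos assms(1) by (simp add: log_le_cancel_iff)
qed

lemma ln_one_plus_ge: "\<epsilon> > 0 \<Longrightarrow> \<epsilon> / (1 + \<epsilon>) \<le> ln (1 + \<epsilon> :: real)"
  using ln_le_minus_one[of "1 / (1 + \<epsilon>)"] by (simp add: ln_div field_simps)

text \<open>
  This is where the size of numbers pays off: the logarithm of a positive number of size \<open>k\<close> is at
  most \<open>k\<close> in absolute value, so the number of grades is linear in \<open>k\<close>.
\<close>

lemma grade_range:
  assumes "\<epsilon> > 0" "has_size k w" "w \<ge> 0"
  defines "B \<equiv> \<lceil>real k * (1 + 1 / \<epsilon>)\<rceil>"
  shows "grade \<epsilon> w \<in> UNIV \<times> {- B..B}"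
proof -
  have "\<bar>log (1 + \<epsilon>) w\<bar> \<le> real k * (1 + 1 / \<epsilon>)"
  proof (cases "w = 0")
    case True
    then show ?thesis using assms(1) by (simp add: log_def)
  next
    case False
    then have w: "w > 0" using assms by simp
    have "ln w \<le> ln (2 ^ k)" "ln (1 / 2 ^ k) \<le> ln w"
      using w has_size_bounds[OF assms(2) w] by (subst ln_le_cancel_iff; simp)+
    then have "\<bar>ln w\<bar> \<le> real k * ln 2" by (simp add: ln_realpow ln_div abs_le_iff)
    also have "\<dots> \<le> real k * 1" by (intro mult_left_mono) (use ln_2_less_1 in auto)
    finally have "\<bar>ln w\<bar> / ln (1 + \<epsilon>) \<le> real k / (\<epsilon> / (1 + \<epsilon>))"
      using ln_one_plus_ge[OF assms(1)] assms(1) by (intro frac_le) auto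
    then show ?thesis using assms(1) by (simp add: log_def field_simps)
  qed
  then show ?thesis unfolding grade_def B_def by (simp, linarith)
qed

section \<open>The invariant of the algorithm\<close>

text \<open>
  The vertices are recorded next to the grades, so that equal profiles refer to the same vertices.
\<close>

definition profile ::
  "('p::finite, 'x) ppinst \<Rightarrow> real \<Rightarrow> (real, 'p) vec list \<Rightarrow> 'x \<Rightarrow> ((real, 'p) vec \<times> bool \<times> int) list" where
  "profile I \<epsilon> vs x = map (\<lambda>v. (v, grade \<epsilon> (obj_val I v x))) vs"

lemma obj_val_inner: "obj_val I lam x = fst (objs I x) \<bullet> lam + snd (objs I x)"
  by (simp add: obj_val_def inner_vec_def mult.commute)

text \<open>
  The set of parameters at which \<open>x\<close> is at most \<open>1 + \<epsilon>\<close> times as expensive as \<open>y\<close> is a halfspace. It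
  contains the convex hull of \<open>vs\<close> as soon as it contains \<open>vs\<close>.
\<close>

lemma same_profile_le:
  assumes eq: "profile I \<epsilon> vs x = profile I \<epsilon> ws y" and lam: "lam \<in> convex hull set vs" and "\<epsilon> > 0"
    and nonneg: "\<And>v. v \<in> set vs \<Longrightarrow> obj_val I v x \<ge> 0 \<and> obj_val I v y \<ge> 0"
  shows "obj_val I lam x \<le> (1 + \<epsilon>) * obj_val I lam y"
proof -
  let ?P = "{lam. obj_val I lam x \<le> (1 + \<epsilon>) * obj_val I lam y}"
  have "map fst (profile I \<epsilon> vs x) = map fst (profile I \<epsilon> ws y)" using eq by simp
  then have "vs = ws" by (simp add: profile_def o_def)
  have "?P = {lam. (fst (objs I x) - (1 + \<epsilon>) *\<^sub>R fst (objs I y)) \<bullet> lam \<le> (1 + \<epsilon>) * snd (objs I y) - snd (objs I x)}"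
    by (auto simp: obj_val_inner inner_diff_left algebra_simps)
  then have "convex ?P" by (simp add: convex_halfspace_le)
  moreover have "set vs \<subseteq> ?P"
    using eq nonneg \<open>\<epsilon> > 0\<close> unfolding profile_def \<open>vs = ws\<close>[symmetric] by (auto intro!: same_grade_le)
  ultimately have "convex hull set vs \<subseteq> ?P" by (rule hull_minimal[rotated])
  then show ?thesis using lam by blast
qed

text \<open>
  Caratheodory's theorem gives at most \<open>p + 1\<close> vertices. Repeating one of them brings the list to
  exactly \<open>p + 1\<close> entries, which makes profiles words of a fixed length over a finite alphabet.
\<close>

lemma polytope_vertex_list:
  fixes P :: "(real, 'p::finite) vec set"
  assumes "polytope P" "lam \<in> P"
  obtains vs where "set vs \<subseteq> vert P" "length vs = CARD('p) + 1" "lam \<in> convex hull set vs"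
proof -
  have "lam \<in> convex hull vert P"
    using Krein_Milman_Minkowski[of P] assms polytope_imp_compact polytope_imp_convex
    by (auto simp: vert_def)
  then obtain T where T: "finite T" "T \<subseteq> vert P" "card T \<le> CARD('p) + 1" "lam \<in> convex hull T"
    unfolding caratheodory[of "vert P"] by auto
  obtain ts where ts: "set ts = T" "length ts = card T"
    by (metis T(1) finite_distinct_list distinct_card)
  have "T \<noteq> {}" using T(4) by auto
  define vs where "vs = ts @ replicate (CARD('p) + 1 - card T) (hd ts)"
  have "set vs = T"
    using \<open>T \<noteq> {}\<close> ts(1) by (auto simp: vs_def set_replicate_conv_if)
  then show thesis using T ts by (intro that[of vs]) (auto simp: vs_def)
qed

text \<open>
  The list \<open>\<tau> x\<close> consists of vertices whose hull contains the parameter at which \<open>x\<close> was added. A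
  new solution violates the \<open>(1 + \<epsilon>)\<close>-approximation by each old one at that parameter, and so its
  profile differs from all old profiles, whatever lists the old solutions carry. The inclusion
  \<open>W \<subseteq> below_all I S\<close> is kept in the invariant because it bounds \<open>z\<close> by the values of the old solutions.
\<close>

lemma run_distinct_profiles:
  fixes I :: "('p::{finite,linorder}, 'x) ppinst"
  assumes run: "run I \<epsilon> Alg V S W"
    and poly: "polytope (params I)" and eps: "\<epsilon> > 0"
    and Alg: "\<And>lam. lam \<in> params I \<Longrightarrow> Alg lam \<in> short_sols \<beta> I"
    and nonneg: "\<And>lam x. lam \<in> params I \<Longrightarrow> x \<in> short_sols \<beta> I \<Longrightarrow> obj_val I lam x \<ge> 0"
  shows "S \<subseteq> short_sols \<beta> I \<and> W \<subseteq> below_all I S \<and>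
    (\<exists>\<tau>. (\<forall>x\<in>S. set (\<tau> x) \<subseteq> vert (params I) \<and> length (\<tau> x) = CARD('p) + 1) \<and>
         inj_on (\<lambda>x. profile I \<epsilon> (\<tau> x) x) S)"
  using run
proof (induction rule: run.induct)
  case (init lam0)
  (* A single profile is distinct in any case, so any list of vertices will do. *)
  obtain vs where "set vs \<subseteq> vert (params I)" "length vs = CARD('p) + 1"
    using polytope_vertex_list[OF poly init] .
  then show ?case
    using Alg[OF init] by (auto simp: vert_def extreme_point_of_def intro!: exI[of _ "\<lambda>_. vs"])
next
  case (skip V S W lam z)
  then show ?case by blast
next
  case (keep V S W lam z)
  then show ?case by blast
next
  case (extend V S W lam z)
  let ?x = "Alg lam"
  obtain \<tau> where \<tau>: "\<forall>x\<in>S. set (\<tau> x) \<subseteq> vert (params I) \<and> length (\<tau> x) = CARD('p) + 1"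
    "inj_on (\<lambda>x. profile I \<epsilon> (\<tau> x) x) S" and S: "S \<subseteq> short_sols \<beta> I"
    using extend.IH by blast
  have "(lam, z) \<in> below_all I S" using extend by blast
  then have lam: "lam \<in> params I" and z: "\<And>x. x \<in> S \<Longrightarrow> z \<le> obj_val I lam x"
    by (auto simp: below_all_def below_def)
  have x: "?x \<in> short_sols \<beta> I" by (rule Alg[OF lam])
  obtain vs where vs: "set vs \<subseteq> vert (params I)" "length vs = CARD('p) + 1" "lam \<in> convex hull set vs"
    using polytope_vertex_list[OF poly lam] .
  have less: "(1 + \<epsilon>) * obj_val I lam ?x < obj_val I lam y" if "y \<in> S" for y
    using extend.hyps(4) z[OF that] by linarith
  have vp: "v \<in> params I" if "v \<in> set vs" for v
    using vs(1) that by (auto simp: vert_def extreme_point_of_def)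
  have new: "profile I \<epsilon> vs ?x \<noteq> profile I \<epsilon> (\<tau> y) y" if "y \<in> S" for y
  proof
    assume eq: "profile I \<epsilon> vs ?x = profile I \<epsilon> (\<tau> y) y"
    then have "map fst (profile I \<epsilon> vs ?x) = map fst (profile I \<epsilon> (\<tau> y) y)" by simp
    then have "\<tau> y = vs" by (simp add: profile_def o_def)
    then have "obj_val I lam y \<le> (1 + \<epsilon>) * obj_val I lam ?x"
      using eq that S x vs(3) eps by (intro same_profile_le[of _ _ vs _ vs]) (auto intro!: nonneg vp)
    then show False using less[OF that] by linarith
  qed
  (* Redefining the list of the new solution must not change the profile of an old one. *)
  have notin: "?x \<notin> S"
  proof
    assume "?x \<in> S"
    moreover have "obj_val I lam ?x \<le> (1 + \<epsilon>) * obj_val I lam ?x"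
      using nonneg[OF lam x] eps by (simp add: algebra_simps)
    ultimately show False using less by fastforce
  qed
  have "inj_on (\<lambda>y. profile I \<epsilon> ((\<tau>(?x := vs)) y) y) (insert ?x S)"
    using \<tau>(2) new notin unfolding inj_on_def by (auto; metis)
  moreover have "\<forall>y\<in>insert ?x S. set ((\<tau>(?x := vs)) y) \<subseteq> vert (params I) \<and> length ((\<tau>(?x := vs)) y) = CARD('p) + 1"
    using \<tau>(1) vs by simp
  moreover have "vert (below_all I (insert ?x S)) \<subseteq> below_all I (insert ?x S)"
    by (auto simp: vert_def extreme_point_of_def)
  ultimately show ?case using S x by blast
qed

lemma card_final_set:
  fixes I :: "('p::{finite,linorder}, 'x) ppinst"
  assumes final: "final_set I \<epsilon> Alg S"
    and poly: "polytope (params I)" and eps: "\<epsilon> > 0"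
    and Alg: "\<And>lam. lam \<in> params I \<Longrightarrow> Alg lam \<in> short_sols \<beta> I"
    and nonneg: "\<And>lam x. lam \<in> params I \<Longrightarrow> x \<in> short_sols \<beta> I \<Longrightarrow> obj_val I lam x \<ge> 0"
    and size: "\<And>v x. v \<in> vert (params I) \<Longrightarrow> x \<in> short_sols \<beta> I \<Longrightarrow> has_size N (obj_val I v x)"
  shows "real (card S) \<le>
    (real (length (ineqs I)) ^ CARD('p) * (4 * real N * (1 + 1 / \<epsilon>) + 6)) ^ (CARD('p) + 1)"
proof -
  obtain V where run: "run I \<epsilon> Alg V S {}" using final by (auto simp: final_set_def)
  obtain \<tau> where S: "S \<subseteq> short_sols \<beta> I"
    and \<tau>: "\<And>x. x \<in> S \<Longrightarrow> set (\<tau> x) \<subseteq> vert (params I)" "\<And>x. x \<in> S \<Longrightarrow> length (\<tau> x) = CARD('p) + 1"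
    and inj: "inj_on (\<lambda>x. profile I \<epsilon> (\<tau> x) x) S"
    using run_distinct_profiles[where \<beta> = \<beta>, OF run poly eps] Alg nonneg by blast
  define B where "B = \<lceil>real N * (1 + 1 / \<epsilon>)\<rceil>"
  define K where "K = vert (params I) \<times> (UNIV :: bool set) \<times> {- B..B}"
  have "0 \<le> real N * (1 + 1 / \<epsilon>)" using eps by simp
  then have B0: "B \<ge> 0" unfolding B_def by linarith
  have finK: "finite K" unfolding K_def using card_vert_params(1)[of I] by simp
  have "profile I \<epsilon> (\<tau> x) x \<in> {ys. set ys \<subseteq> K \<and> length ys = CARD('p) + 1}" if x: "x \<in> S" for x
  proof -
    have "(v, grade \<epsilon> (obj_val I v x)) \<in> K" if "v \<in> set (\<tau> x)" for v
    proof -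
      have v: "v \<in> vert (params I)" using \<tau>(1)[OF x] that by blast
      then have "v \<in> params I" by (simp add: vert_def extreme_point_of_def)
      then show ?thesis
        using grade_range[OF eps size[OF v] nonneg] S x v unfolding K_def B_def by blast
    qed
    then show ?thesis using \<tau>(2)[OF x] by (auto simp: profile_def)
  qed
  then have "card S \<le> card {ys. set ys \<subseteq> K \<and> length ys = CARD('p) + 1}"
    by (intro card_inj_on_le[OF inj] finite_lists_length_eq finK) blast
  then have "card S \<le> card K ^ (CARD('p) + 1)" by (simp add: card_lists_length_eq[OF finK])
  then have "real (card S) \<le> real (card K) ^ (CARD('p) + 1)"
    by (metis of_nat_le_iff of_nat_power)
  also have "\<dots> \<le> (real (length (ineqs I)) ^ CARD('p) * (4 * real N * (1 + 1 / \<epsilon>) + 6)) ^ (CARD('p) + 1)"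
  proof (rule power_mono)
    have "real (card K) = real (card (vert (params I))) * (2 * (2 * real_of_int B + 1))"
      using B0 by (simp add: K_def card_cartesian_product)
    also have "\<dots> \<le> real (length (ineqs I) ^ CARD('p)) * (4 * real N * (1 + 1 / \<epsilon>) + 6)"
    proof (rule mult_mono)
      show "real (card (vert (params I))) \<le> real (length (ineqs I) ^ CARD('p))"
        using card_vert_params(2)[of I] by (simp only: of_nat_le_iff)
      have "4 * real_of_int \<lceil>t\<rceil> + 2 \<le> 4 * t + 6" for t :: real by linarith
      from this[of "real N * (1 + 1 / \<epsilon>)"]
      show "2 * (2 * real_of_int B + 1) \<le> 4 * real N * (1 + 1 / \<epsilon>) + 6"
        by (simp add: B_def distrib_left mult.assoc)
    qed (use B0 in auto)
    finally show "real (card K) \<le> real (length (ineqs I)) ^ CARD('p) * (4 * real N * (1 + 1 / \<epsilon>) + 6)"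
      by simp
  qed simp
  finally show ?thesis .
qed

theorem theorem5:
  fixes Prob :: "('p::{finite,linorder}, 'x) ppinst set"
    and \<beta> :: "nat poly"
  assumes "parametric_problem Prob \<beta>"
  shows "\<exists>C>0. \<exists>R :: real poly poly.
    \<forall>I\<in>Prob. \<forall>\<epsilon> \<alpha> :: real. \<forall>Alg S.
      polytope (params I) \<longrightarrow> \<epsilon> > 0 \<longrightarrow> \<alpha> \<ge> 1 \<longrightarrow>
      approx_alg \<beta> \<alpha> I Alg \<longrightarrow> final_set I \<epsilon> Alg S \<longrightarrow>
      real (card S) \<le>
        C * (real (length (ineqs I)) ^ (nat \<lfloor>real CARD('p) / 2\<rfloor> * nat \<lceil>real CARD('p) / 2\<rceil>) *
             poly2 R (real (inst_length I)) (1 / \<epsilon>) ^ (CARD('p) + 1))"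
proof -
  interpret parametric_problem Prob \<beta> by (rule assms)
  obtain N :: "nat poly" where N: "\<And>I x v. I \<in> Prob \<Longrightarrow> x \<in> short_sols \<beta> I \<Longrightarrow>
      v \<in> vert (params I) \<Longrightarrow> has_size (poly N (inst_length I)) (obj_val I v x)"
    using vertex_obj_val_size[OF polytime, where \<beta> = \<beta>] by blast
  define P :: "real poly" where "P = map_poly real N"
  (* The outer variable stands for 1 / \<epsilon>; length (ineqs I) is replaced by its bound inst_length I. *)
  define R :: "real poly poly"
    where "R = [:monom 1 CARD('p) * (4 * P + 6), monom 1 CARD('p) * (4 * P):]"
  have poly2_R: "poly2 R (real n) (1 / \<epsilon>) =
      real n ^ CARD('p) * (4 * real (poly N n) * (1 + 1 / \<epsilon>) + 6)" for n \<epsilon>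
    by (simp add: poly2_def R_def P_def poly_monom poly_map_poly_real algebra_simps)
  have bound: "real (card S) \<le>
      1 * (real (length (ineqs I)) ^ (nat \<lfloor>real CARD('p) / 2\<rfloor> * nat \<lceil>real CARD('p) / 2\<rceil>) *
           poly2 R (real (inst_length I)) (1 / \<epsilon>) ^ (CARD('p) + 1))"
    if I: "I \<in> Prob" and poly: "polytope (params I)" and eps: "\<epsilon> > 0"
      and Alg: "approx_alg \<beta> \<alpha> I Alg" and final: "final_set I \<epsilon> Alg S" for I \<epsilon> \<alpha> Alg S
  proof -
    let ?m = "real (length (ineqs I))" and ?L = "inst_length I"
    let ?Q = "poly2 R (real ?L) (1 / \<epsilon>) ^ (CARD('p) + 1)"
    let ?K = "4 * real (poly N ?L) * (1 + 1 / \<epsilon>) + 6"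
    have "real (card S) \<le> (?m ^ CARD('p) * ?K) ^ (CARD('p) + 1)"
    proof (rule card_final_set[OF final poly eps])
      show "Alg lam \<in> short_sols \<beta> I" if "lam \<in> params I" for lam
        using Alg that by (simp add: approx_alg_def)
      show "obj_val I lam x \<ge> 0" if "lam \<in> params I" "x \<in> short_sols \<beta> I" for lam x
        using nonneg[OF I that(1)] that(2) by (simp add: short_sols_def)
    qed (rule N[OF I])
    also have "\<dots> \<le> ?Q"
      unfolding poly2_R using eps length_ineqs_le_inst_length[of I]
      by (intro power_mono mult_mono) auto
    finally have card: "real (card S) \<le> ?Q" .
    have "?m \<ge> 1" using ineqs_nonempty[OF I] by (simp add: Suc_le_eq)
    then have "1 \<le> ?m ^ (nat \<lfloor>real CARD('p) / 2\<rfloor> * nat \<lceil>real CARD('p) / 2\<rceil>)" by (rule one_le_power)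
    from mult_right_mono[OF this, of ?Q] show ?thesis using card by linarith
  qed
  show ?thesis
    by (intro exI[of _ "1 :: real"] conjI zero_less_one exI[of _ R] ballI allI impI) (rule bound)
qed

end
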